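(* Let $A\in\mathbb{R}^{m\times n}$. If $P\in\mathbb{R}^{m\times m}$ and $Q\in\mathbb{R}^{n\times n}$ are square orthogonal matrices (i.e. $P^TP=I_m$ and $Q^TQ=I_n$), then $$A^+ = Q\,(P^TAQ)^+\,P^T.$$
   Context: All matrices are real. For a matrix $M$, $M^+$ denotes its Moore–Penrose pseudoinverse, i.e. the unique matrix with $MM^+M=M$, $M^+MM^+=M^+$, $(M^+M)^T=M^+M$, $(MM^+)^T=MM^+$. *)

theory Defs
  imports "HOL-Analysis.Analysis"
begin

definition is_pinv :: "real ^ 'n ^ 'm \<Rightarrow> real ^ 'm ^ 'n \<Rightarrow> bool" where
  "is_pinv M X \<longleftrightarrow>
     M ** X ** M = M \<and> X ** M ** X = X \<and>
     transpose (X ** M) = X ** M \<and> transpose (M ** X) = M ** X"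

definition pinv :: "real ^ 'n ^ 'm \<Rightarrow> real ^ 'm ^ 'n" where
  "pinv M = (THE X. is_pinv M X)"

text \<open>The description in \<open>pinv\<close> is proper: every real matrix has exactly one
  Moore--Penrose inverse.\<close>

lemma is_pinv_unique:
  fixes M :: "real ^ 'n ^ 'm"
  assumes X: "is_pinv M X" and Y: "is_pinv M Y"
  shows "X = Y"
proof -
  have MX: "M ** X = M ** Y"
  proof -
    have "M ** X = transpose (M ** Y ** (M ** X))"
      using X Y by (metis is_pinv_def matrix_mul_assoc)
    also have "\<dots> = M ** X ** (M ** Y)"
      using X Y by (metis is_pinv_def matrix_transpose_mul)
    also have "\<dots> = M ** Y"
      using X by (metis is_pinv_def matrix_mul_assoc)
    finally show ?thesis .
  qed
  have XM: "X ** M = Y ** M"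
  proof -
    have "X ** M = transpose (X ** M ** (Y ** M))"
      using X Y by (metis is_pinv_def matrix_mul_assoc)
    also have "\<dots> = Y ** M ** (X ** M)"
      using X Y by (metis is_pinv_def matrix_transpose_mul)
    also have "\<dots> = Y ** M"
      using X by (metis is_pinv_def matrix_mul_assoc)
    finally show ?thesis .
  qed
  show ?thesis
    using X Y MX XM by (metis is_pinv_def matrix_mul_assoc)
qed

lemma matrix_diff_ldistrib:
  fixes A :: "real ^ 'n ^ 'm" and B C :: "real ^ 'p ^ 'n"
  shows "A ** (B - C) = A ** B - A ** C"
  by (simp add: matrix_eq matrix_vector_mul_assoc[symmetric] matrix_vector_mult_diff_rdistrib
      matrix_vector_mult_diff_distrib)

lemma gram_eq_0:
  fixes N :: "real ^ 'n ^ 'm"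
  assumes "transpose N ** N = 0"
  shows "N = 0"
proof -
  have "N *v x = 0" for x
  proof -
    have "(N *v x) \<bullet> (N *v x) = x \<bullet> ((transpose N ** N) *v x)"
      by (metis dot_lmul_matrix inner_commute matrix_vector_mul_assoc transpose_matrix_vector)
    then show ?thesis using assms by simp
  qed
  then show ?thesis by (simp add: matrix_eq)
qed

lemma ex_inner_inverse:
  fixes M :: "real ^ 'n ^ 'm"
  shows "\<exists>K. M ** K ** M = M"
proof -
  have "linear ((*v) M)" by simp
  then obtain g where g: "linear g" "\<forall>y\<in>range ((*v) M). M *v g y = y"
    using linear_exists_right_inverse_on[of "(*v) M" UNIV] by auto
  have "M ** matrix g ** M = M"
    unfolding matrix_eq using g
    by (simp add: matrix_vector_mul_assoc[symmetric])
  then show ?thesis ..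
qed

lemma ex_least_squares_inverse:
  fixes M :: "real ^ 'n ^ 'm"
  shows "\<exists>G. M ** G ** M = M \<and> transpose (M ** G) = M ** G"
proof -
  let ?T = "transpose M"
  obtain K where K: "?T ** M ** K ** (?T ** M) = ?T ** M"
    using ex_inner_inverse by blast
  define L where "L = M ** K ** ?T ** M"
  have TL: "?T ** L = ?T ** M"
    using K by (simp add: L_def matrix_mul_assoc)
  have "L - M = M ** (K ** ?T ** M - mat 1)"
    by (simp add: L_def matrix_diff_ldistrib matrix_mul_assoc)
  then have "transpose (L - M) = transpose (K ** ?T ** M - mat 1) ** ?T"
    by (simp add: matrix_transpose_mul)
  then have "transpose (L - M) ** (L - M) = transpose (K ** ?T ** M - mat 1) ** (?T ** (L - M))"
    by (metis matrix_mul_assoc)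
  then have "transpose (L - M) ** (L - M) = 0"
    by (simp add: TL matrix_diff_ldistrib)
  then have L: "M ** K ** ?T ** M = M"
    using gram_eq_0 unfolding L_def by fastforce
  define G where "G = transpose K ** ?T"
  have nrm: "?T ** M ** G = ?T"
    using arg_cong[OF L, of transpose]
    by (simp add: G_def matrix_transpose_mul matrix_mul_assoc)
  have "transpose G ** ?T ** M ** G = transpose G ** ?T"
    by (metis nrm matrix_mul_assoc)
  then have sym: "transpose (M ** G) = M ** G"
    by (metis matrix_mul_assoc matrix_transpose_mul transpose_transpose)
  have "M ** G ** M = M"
    by (metis sym nrm matrix_mul_assoc matrix_transpose_mul transpose_transpose)
  with sym show ?thesis by blast
qed

lemma ex_is_pinv:
  fixes M :: "real ^ 'n ^ 'm"
  shows "\<exists>X. is_pinv M X"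
proof -
  obtain G where G: "M ** G ** M = M" "transpose (M ** G) = M ** G"
    using ex_least_squares_inverse by blast
  obtain H' where H': "transpose M ** H' ** transpose M = transpose M"
      "transpose (transpose M ** H') = transpose M ** H'"
    using ex_least_squares_inverse by blast
  define H where "H = transpose H'"
  have H: "M ** H ** M = M" "transpose (H ** M) = H ** M"
    using H' unfolding H_def
    by (metis matrix_mul_assoc matrix_transpose_mul transpose_transpose)+
  have MX: "M ** (H ** M ** G) = M ** G" and XM: "H ** M ** G ** M = H ** M"
    using G(1) H(1) by (metis matrix_mul_assoc)+
  have "H ** M ** G ** M ** (H ** M ** G) = H ** M ** G"
    using XM H(1) by (metis matrix_mul_assoc)
  then have "is_pinv M (H ** M ** G)"
    unfolding is_pinv_def using MX XM G H by simp
  then show ?thesis ..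
qed

lemma ex1_is_pinv: "\<exists>!X. is_pinv M X"
  using ex_is_pinv is_pinv_unique by blast

lemma is_pinv_pinv: "is_pinv M (pinv M)"
  unfolding pinv_def by (rule theI'[OF ex1_is_pinv])

end

theory Submission
  imports Defs
begin

text \<open>The four Penrose equations survive an orthogonal change of basis on both sides: if
  \<open>X\<close> is a pseudoinverse of \<open>M\<close>, then \<open>V ** X ** transpose U\<close>
  is one of \<open>U ** M ** transpose V\<close> (\<open>is_pinv_orthogonal\<close>). For
  \<open>M = transpose P ** A ** Q\<close>, \<open>U = P\<close>, \<open>V = Q\<close> the
  transformed matrix is \<open>A\<close> itself, and \<open>is_pinv_unique\<close> gives the
  equality.\<close>

lemma orthogonal_matrix_cancel:
  fixes U :: "real ^ 'k ^ 'k" and X :: "real ^ 'k ^ 'l" and Y :: "real ^ 'p ^ 'k"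
  assumes "orthogonal_matrix U"
  shows "(X ** transpose U) ** (U ** Y) = X ** Y"
  using assms unfolding orthogonal_matrix_def
  by (metis matrix_mul_assoc matrix_mul_rid)

text \<open>Where the two transformed matrices meet, \<open>transpose V ** V\<close> or
  \<open>transpose U ** U\<close> cancels, so their products are the conjugates of
  \<open>M ** X\<close> by \<open>U\<close> and of \<open>X ** M\<close> by \<open>V\<close>.
  Conjugation keeps these symmetric, and one more cancellation gives the other two
  equations.\<close>

lemma is_pinv_orthogonal:
  fixes M :: "real ^ 'n ^ 'm" and U :: "real ^ 'm ^ 'm" and V :: "real ^ 'n ^ 'n"
  assumes U: "orthogonal_matrix U" and V: "orthogonal_matrix V" and "is_pinv M X"
  shows "is_pinv (U ** M ** transpose V) (V ** X ** transpose U)"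
proof -
  let ?M = "U ** M ** transpose V" and ?X = "V ** X ** transpose U"
  have X: "M ** X ** M = M" "X ** M ** X = X"
    "transpose (X ** M) = X ** M" "transpose (M ** X) = M ** X"
    using assms(3) by (simp_all add: is_pinv_def)
  have MX: "?M ** ?X = U ** (M ** X) ** transpose U"
    by (metis orthogonal_matrix_cancel[OF V] matrix_mul_assoc)
  have XM: "?X ** ?M = V ** (X ** M) ** transpose V"
    by (metis orthogonal_matrix_cancel[OF U] matrix_mul_assoc)
  have "?M ** ?X ** ?M = ?M"
    unfolding MX by (metis X(1) orthogonal_matrix_cancel[OF U] matrix_mul_assoc)
  moreover have "?X ** ?M ** ?X = ?X"
    unfolding XM by (metis X(2) orthogonal_matrix_cancel[OF V] matrix_mul_assoc)
  moreover have "transpose (?X ** ?M) = ?X ** ?M"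
    unfolding XM by (metis X(3) matrix_transpose_mul transpose_transpose matrix_mul_assoc)
  moreover have "transpose (?M ** ?X) = ?M ** ?X"
    unfolding MX by (metis X(4) matrix_transpose_mul transpose_transpose matrix_mul_assoc)
  ultimately show ?thesis
    by (simp add: is_pinv_def)
qed

theorem theorem7:
  fixes A :: "real ^ 'n ^ 'm" and P :: "real ^ 'm ^ 'm" and Q :: "real ^ 'n ^ 'n"
  assumes "orthogonal_matrix P" and "orthogonal_matrix Q"
  shows "pinv A = Q ** pinv (transpose P ** A ** Q) ** transpose P"
proof -
  \<comment> \<open>Recovering \<open>A\<close> uses the other half of orthogonality,
    \<open>P ** transpose P = mat 1\<close>, and likewise for \<open>Q\<close>.\<close>
  have "P ** (transpose P ** A ** Q) ** transpose Q = (P ** transpose P) ** A ** (Q ** transpose Q)"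
    by (simp add: matrix_mul_assoc)
  also have "\<dots> = A"
    using assms by (simp add: orthogonal_matrix_def)
  finally have "is_pinv A (Q ** pinv (transpose P ** A ** Q) ** transpose P)"
    using is_pinv_orthogonal[OF assms is_pinv_pinv] by metis
  then show ?thesis
    using is_pinv_pinv is_pinv_unique by blast
qed

end
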